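(* Let $P$ and $Q$ be posets, and let $f: P \leftrightarrows Q : g$ be a Galois connection, with left adjoint $f:P\to Q$ and right adjoint $g:Q\to P$. For any function $m: P \to \mathbb{Z}$, if $m$ is Möbius invertible, then $g^\sharp m : Q\to\mathbb{Z}$ is Möbius invertible and $$\partial_Q\big(g^\sharp m\big) = f_\sharp(\partial_P m).$$
   Context: Posets are not assumed finite. A Galois connection $f: P \leftrightarrows Q : g$ between posets consists of order-preserving maps $f:P\to Q$ and $g:Q\to P$ such that $f(p)\le q$ if and only if $p\le g(q)$ for all $p\in P$, $q\in Q$; $f$ is the left adjoint and $g$ the right adjoint. Functions $m:P\to\mathbb{Z}$ are arbitrary (not necessarily order-preserving). A Möbius inversion of $m:P\to\mathbb{Z}$ is a function $m':P\to\mathbb{Z}$ such that for every $b\in P$ one has $m(b)=\sum_{a\le b} m'(a)$, where the right-hand side has only finitely many nonzero summands. $m$ is Möbius invertible if a Möbius inversion exists; it is then unique and is denoted $\partial_P m$. For a function $f:P\to Q$ and $m:P\to\mathbb{Z}$, the pushforward $f_\sharp m:Q\to\mathbb{Z}$ is $(f_\sharp m)(q)=\sum_{p\in f^{-1}(q)} m(p)$ (when these sums have finitely many nonzero terms). For a function $g:Q\to P$ and $m:P\to\mathbb{Z}$, the pullback is $g^\sharp m = m\circ g:Q\to\mathbb{Z}$. *)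

theory Defs
  imports "HOL-Algebra.Galois_Connection" "HOL-Library.FuncSet"
begin

text \<open>
  Posets are carrier-based, so a function on a poset is determined only by its values on the
  carrier. The operators producing a function on a poset return an extensional one (value
  \<^term>\<open>undefined\<close> off the carrier), so that equality in HOL is equality of functions on the poset.

  Sums with finitely many nonzero summands are written with \<^term>\<open>sum'\<close>, which is 0 by convention
  when infinitely many summands are nonzero. Finiteness is therefore always required explicitly.
\<close>

definition moebius_inversion ::
    "('a, 'c) gorder_scheme \<Rightarrow> ('a \<Rightarrow> int) \<Rightarrow> ('a \<Rightarrow> int) \<Rightarrow> bool" where
  "moebius_inversion P m m' \<longleftrightarrow>
     (\<forall>b \<in> carrier P.
        finite {a \<in> carrier P. a \<sqsubseteq>\<^bsub>P\<^esub> b \<and> m' a \<noteq> 0} \<and>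
        m b = sum' m' {a \<in> carrier P. a \<sqsubseteq>\<^bsub>P\<^esub> b})"

definition moebius_invertible :: "('a, 'c) gorder_scheme \<Rightarrow> ('a \<Rightarrow> int) \<Rightarrow> bool" where
  "moebius_invertible P m \<longleftrightarrow> (\<exists>m'. moebius_inversion P m m')"

text \<open>Meaningful only for Moebius invertible \<^term>\<open>m\<close>; see \<open>moebius_deriv_eqI\<close> below.\<close>

definition moebius_deriv :: "('a, 'c) gorder_scheme \<Rightarrow> ('a \<Rightarrow> int) \<Rightarrow> 'a \<Rightarrow> int" where
  "moebius_deriv P m = (THE m'. m' \<in> extensional (carrier P) \<and> moebius_inversion P m m')"

definition pushforward_defined ::
    "('a, 'c) gorder_scheme \<Rightarrow> ('b, 'd) gorder_scheme \<Rightarrow> ('a \<Rightarrow> 'b) \<Rightarrow> ('a \<Rightarrow> int) \<Rightarrow> bool" where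
  "pushforward_defined P Q f m \<longleftrightarrow>
     (\<forall>q \<in> carrier Q. finite {p \<in> carrier P. f p = q \<and> m p \<noteq> 0})"

definition pushforward ::
    "('a, 'c) gorder_scheme \<Rightarrow> ('b, 'd) gorder_scheme \<Rightarrow> ('a \<Rightarrow> 'b) \<Rightarrow> ('a \<Rightarrow> int) \<Rightarrow> 'b \<Rightarrow> int" where
  "pushforward P Q f m = (\<lambda>q \<in> carrier Q. sum' m {p \<in> carrier P. f p = q})"

definition pullback ::
    "('b, 'd) gorder_scheme \<Rightarrow> ('b \<Rightarrow> 'a) \<Rightarrow> ('a \<Rightarrow> int) \<Rightarrow> 'b \<Rightarrow> int" where
  "pullback Q g m = compose (carrier Q) m g"

lemma sum'_eq_sum_support:
  "finite {a \<in> A. h a \<noteq> 0} \<Longrightarrow> sum' h A = sum h {a \<in> A. h a \<noteq> 0}"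
  by (simp add: sum.G_def)

lemma moebius_inversion_unique:
  assumes P: "partial_order P"
    and 1: "moebius_inversion P m m1" and 2: "moebius_inversion P m m2"
    and b: "b \<in> carrier P"
  shows "m1 b = m2 b"
proof (rule ccontr)
  interpret partial_order P by fact
  define D where "D c = {a \<in> carrier P. a \<sqsubseteq>\<^bsub>P\<^esub> c \<and> m1 a \<noteq> m2 a}" for c
  have supp: "D c \<subseteq> {a \<in> carrier P. a \<sqsubseteq>\<^bsub>P\<^esub> c \<and> m1 a \<noteq> 0} \<union> {a \<in> carrier P. a \<sqsubseteq>\<^bsub>P\<^esub> c \<and> m2 a \<noteq> 0}" for c
    by (auto simp: D_def)
  have fin: "finite (D c)" if "c \<in> carrier P" for c
    by (rule finite_subset[OF supp]) (use 1 2 that in \<open>simp add: moebius_inversion_def\<close>)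
  have sum0: "(\<Sum>a\<in>D c. m1 a - m2 a) = 0" if c: "c \<in> carrier P" for c
  proof -
    let ?S1 = "{a \<in> carrier P. a \<sqsubseteq>\<^bsub>P\<^esub> c \<and> m1 a \<noteq> 0}"
    let ?S2 = "{a \<in> carrier P. a \<sqsubseteq>\<^bsub>P\<^esub> c \<and> m2 a \<noteq> 0}"
    have f1: "finite ?S1" and f2: "finite ?S2"
      using 1 2 c by (simp_all add: moebius_inversion_def)
    have e1: "m c = sum m1 ?S1" and e2: "m c = sum m2 ?S2"
      using 1 2 c f1 f2 by (simp_all add: moebius_inversion_def sum'_eq_sum_support conj_assoc)
    have "sum m1 (?S1 \<union> ?S2) = sum m1 ?S1" "sum m2 (?S1 \<union> ?S2) = sum m2 ?S2"
      by (rule sum.mono_neutral_right; use f1 f2 in auto)+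
    then have "(\<Sum>a\<in>?S1 \<union> ?S2. m1 a - m2 a) = 0"
      using e1 e2 by (simp add: sum_subtractf)
    moreover have "(\<Sum>a\<in>?S1 \<union> ?S2. m1 a - m2 a) = (\<Sum>a\<in>D c. m1 a - m2 a)"
      by (rule sum.mono_neutral_right) (use f1 f2 in \<open>auto simp: D_def\<close>)
    ultimately show ?thesis by simp
  qed
  assume ne: "m1 b \<noteq> m2 b"
  define c where "c = arg_min (\<lambda>c. card (D c)) (\<lambda>c. c \<in> D b)"
  have bD: "b \<in> D b" using b ne by (simp add: D_def)
  have c: "c \<in> D b" and cmin: "\<And>y. y \<in> D b \<Longrightarrow> card (D c) \<le> card (D y)"
    unfolding c_def using arg_min_nat_lemma[of "\<lambda>c. c \<in> D b" b "\<lambda>c. card (D c)"] bD by blast+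
  have cP: "c \<in> carrier P" and cb: "c \<sqsubseteq>\<^bsub>P\<^esub> b" and cne: "m1 c \<noteq> m2 c"
    using c by (auto simp: D_def)
  have "D c = {c}"
  proof (rule ccontr)
    assume "D c \<noteq> {c}"
    moreover have "c \<in> D c" using cP cne by (simp add: D_def)
    ultimately obtain d where d: "d \<in> D c" "d \<noteq> c" by blast
    have dP: "d \<in> carrier P" and dc: "d \<sqsubseteq>\<^bsub>P\<^esub> c" using d by (auto simp: D_def)
    have "d \<in> D b" using d cb cP b by (auto simp: D_def intro: le_trans)
    moreover have "D d \<subseteq> D c" using dP dc cP by (auto simp: D_def intro: le_trans)
    moreover have "c \<notin> D d" using d dc cP dP by (auto simp: D_def dest: le_antisym)
    ultimately have "D d \<subset> D c" using \<open>c \<in> D c\<close> by blast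
    then have "card (D d) < card (D c)" by (rule psubset_card_mono[OF fin[OF cP]])
    with cmin[OF \<open>d \<in> D b\<close>] show False by simp
  qed
  with sum0[OF cP] cne show False by simp
qed

lemma moebius_deriv_eqI:
  assumes P: "partial_order P" and m': "moebius_inversion P m m'"
  shows "moebius_deriv P m = restrict m' (carrier P)"
  unfolding moebius_deriv_def
proof (rule the_equality)
  have "sum' m' {a \<in> carrier P. a \<sqsubseteq>\<^bsub>P\<^esub> b} = sum' (restrict m' (carrier P)) {a \<in> carrier P. a \<sqsubseteq>\<^bsub>P\<^esub> b}" for b
    by (rule sum.cong') auto
  moreover have "{a \<in> carrier P. a \<sqsubseteq>\<^bsub>P\<^esub> b \<and> restrict m' (carrier P) a \<noteq> 0}
      = {a \<in> carrier P. a \<sqsubseteq>\<^bsub>P\<^esub> b \<and> m' a \<noteq> 0}" for b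
    by auto
  ultimately show "restrict m' (carrier P) \<in> extensional (carrier P) \<and>
      moebius_inversion P m (restrict m' (carrier P))"
    using m' by (simp add: moebius_inversion_def)
  then show "n = restrict m' (carrier P)"
    if "n \<in> extensional (carrier P) \<and> moebius_inversion P m n" for n
    using that by (metis P extensionalityI moebius_inversion_unique)
qed

end

theory Submission
  imports Defs
begin

text \<open>
  By the Galois property, the preimage under \<open>f\<close> of the principal down-set of \<open>q\<close> is the
  principal down-set of \<open>g q\<close>. Let \<open>m'\<close> invert \<open>m\<close>. Then \<open>m (g q)\<close> is the sum of \<open>m'\<close> over
  \<open>{p. p \<le> g q} = {p. f p \<le> q}\<close>, and summing along the fibres of \<open>f\<close> first
  (\<open>sum'_over_fibres\<close>) turns it into the sum of the pushforward of \<open>m'\<close> over \<open>{r. r \<le> q}\<close>.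
  So the pushforward is an inversion of the pullback (\<open>moebius_inversion_pullback\<close>), and it is
  the only one because inversions are unique. All these sums are finite: \<open>m'\<close> has only
  finitely many nonzero values below \<open>g q\<close>, and every fibre over an element below \<open>q\<close> lies
  below \<open>g q\<close>.
\<close>

text \<open>
  A fibre can contribute a nonzero sum only if it meets the support of \<open>h\<close>. So the fibre sums
  are supported on the image of that finite support, and the claim reduces to grouping a
  finite sum by the value of \<open>f\<close>.
\<close>

lemma sum'_over_fibres:
  fixes h :: "'a \<Rightarrow> 'c::comm_monoid_add"
  assumes fin: "finite {a \<in> A. h a \<noteq> 0}" and f: "f ` A \<subseteq> B"
  shows "finite {b \<in> B. sum' h {a \<in> A. f a = b} \<noteq> 0}"
    and "sum' (\<lambda>b. sum' h {a \<in> A. f a = b}) B = sum' h A"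
proof -
  let ?S = "{a \<in> A. h a \<noteq> 0}"
  let ?k = "\<lambda>b. sum' h {a \<in> A. f a = b}"
  have k: "?k b = sum h {a \<in> ?S. f a = b}" for b
  proof -
    have eq: "{a \<in> {a \<in> A. f a = b}. h a \<noteq> 0} = {a \<in> ?S. f a = b}" by blast
    have "finite {a \<in> ?S. f a = b}" by (rule finite_subset[OF _ fin]) blast
    then show ?thesis unfolding sum.G_def eq by (rule if_P)
  qed
  have supp: "{b \<in> B. ?k b \<noteq> 0} \<subseteq> f ` ?S"
  proof
    fix b assume "b \<in> {b \<in> B. ?k b \<noteq> 0}"
    then have "?k b \<noteq> 0" by blast
    then have "sum h {a \<in> ?S. f a = b} \<noteq> 0" unfolding k .
    then obtain a where "a \<in> {a \<in> ?S. f a = b}" by (rule sum.not_neutral_contains_not_neutral)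
    then show "b \<in> f ` ?S" by blast
  qed
  then show finB: "finite {b \<in> B. ?k b \<noteq> 0}"
    by (rule finite_subset) (use fin in simp)
  have "sum' ?k B = sum ?k {b \<in> B. ?k b \<noteq> 0}"
    using finB by (simp add: sum.G_def)
  also have "\<dots> = sum ?k (f ` ?S)"
    by (rule sum.mono_neutral_left) (use fin supp f in auto)
  also have "\<dots> = sum h ?S"
    unfolding k by (rule sum.image_gen[OF fin, symmetric])
  also have "\<dots> = sum' h A"
    using fin by (simp add: sum.G_def)
  finally show "sum' ?k B = sum' h A" .
qed

lemma moebius_inversion_cong:
  assumes "\<And>a. a \<in> carrier P \<Longrightarrow> m1 a = m2 a"
  shows "moebius_inversion P m m1 \<longleftrightarrow> moebius_inversion P m m2"
proof -
  have "sum' m1 {a \<in> carrier P. a \<sqsubseteq>\<^bsub>P\<^esub> b} = sum' m2 {a \<in> carrier P. a \<sqsubseteq>\<^bsub>P\<^esub> b}" for b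
    by (rule sum.cong') (auto simp: assms)
  moreover have "{a \<in> carrier P. a \<sqsubseteq>\<^bsub>P\<^esub> b \<and> m1 a \<noteq> 0} = {a \<in> carrier P. a \<sqsubseteq>\<^bsub>P\<^esub> b \<and> m2 a \<noteq> 0}" for b
    using assms by auto
  ultimately show ?thesis by (simp add: moebius_inversion_def)
qed

lemma moebius_inversion_moebius_deriv:
  assumes "partial_order P" and "moebius_invertible P m"
  shows "moebius_inversion P m (moebius_deriv P m)"
proof -
  obtain m' where m': "moebius_inversion P m m'"
    using assms(2) by (auto simp: moebius_invertible_def)
  show ?thesis
    unfolding moebius_deriv_eqI[OF assms(1) m']
    using m' by (simp cong: moebius_inversion_cong)
qed

text \<open>
  Everything is read off the set \<open>{p. f p \<le> q}\<close>, on which \<open>m'\<close> has finite support because it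
  is the principal down-set of \<open>g q\<close>. It contains the whole fibre over \<open>r\<close> whenever \<open>r \<le> q\<close>;
  with \<open>r = q\<close> this makes each fibre sum finite.
\<close>

lemma moebius_inversion_pullback:
  fixes P :: "('a, 'c) gorder_scheme" and Q :: "('b, 'd) gorder_scheme"
  assumes conn: "galois_connection \<lparr>orderA = P, orderB = Q, lower = f, upper = g\<rparr>"
    and inv: "moebius_inversion P m m'"
  shows "pushforward_defined P Q f m'"
    and "moebius_inversion Q (pullback Q g m) (pushforward P Q f m')"
proof -
  interpret galois_connection "\<lparr>orderA = P, orderB = Q, lower = f, upper = g\<rparr>" by fact
  interpret Q: partial_order Q using is_order_B by simp
  have fQ: "f p \<in> carrier Q" if "p \<in> carrier P" for p
    using lower_closed that by simp
  have gP: "g q \<in> carrier P" if "q \<in> carrier Q" for q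
    using upper_closed that by simp
  have galois: "f p \<sqsubseteq>\<^bsub>Q\<^esub> q \<longleftrightarrow> p \<sqsubseteq>\<^bsub>P\<^esub> g q" if "p \<in> carrier P" "q \<in> carrier Q" for p q
    using galois_property that by simp
  have fin: "finite {p \<in> {p \<in> carrier P. f p \<sqsubseteq>\<^bsub>Q\<^esub> q}. m' p \<noteq> 0}"
    and val: "m (g q) = sum' m' {p \<in> carrier P. f p \<sqsubseteq>\<^bsub>Q\<^esub> q}" if q: "q \<in> carrier Q" for q
  proof -
    have down: "{p \<in> carrier P. f p \<sqsubseteq>\<^bsub>Q\<^esub> q} = {p \<in> carrier P. p \<sqsubseteq>\<^bsub>P\<^esub> g q}"
      using galois q by blast
    show "finite {p \<in> {p \<in> carrier P. f p \<sqsubseteq>\<^bsub>Q\<^esub> q}. m' p \<noteq> 0}"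
      and "m (g q) = sum' m' {p \<in> carrier P. f p \<sqsubseteq>\<^bsub>Q\<^esub> q}"
      unfolding down using inv gP[OF q] by (simp_all add: moebius_inversion_def conj_assoc)
  qed
  show "pushforward_defined P Q f m'"
    unfolding pushforward_defined_def
  proof
    fix q assume q: "q \<in> carrier Q"
    show "finite {p \<in> carrier P. f p = q \<and> m' p \<noteq> 0}"
      by (rule finite_subset[OF _ fin[OF q]]) (use q in auto)
  qed
  show "moebius_inversion Q (pullback Q g m) (pushforward P Q f m')"
    unfolding moebius_inversion_def
  proof (intro ballI conjI)
    fix q assume q: "q \<in> carrier Q"
    let ?A = "{p \<in> carrier P. f p \<sqsubseteq>\<^bsub>Q\<^esub> q}" and ?B = "{r \<in> carrier Q. r \<sqsubseteq>\<^bsub>Q\<^esub> q}"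
    have img: "f ` ?A \<subseteq> ?B" using fQ by auto
    have push: "pushforward P Q f m' r = sum' m' {p \<in> ?A. f p = r}" if "r \<in> ?B" for r
    proof -
      have "{p \<in> ?A. f p = r} = {p \<in> carrier P. f p = r}" using that by auto
      then show ?thesis using that by (simp add: pushforward_def)
    qed
    have "{r \<in> carrier Q. r \<sqsubseteq>\<^bsub>Q\<^esub> q \<and> pushforward P Q f m' r \<noteq> 0}
        = {r \<in> ?B. sum' m' {p \<in> ?A. f p = r} \<noteq> 0}"
      using push by auto
    then show "finite {r \<in> carrier Q. r \<sqsubseteq>\<^bsub>Q\<^esub> q \<and> pushforward P Q f m' r \<noteq> 0}"
      using sum'_over_fibres(1)[OF fin[OF q] img] by simp
    have "pullback Q g m q = sum' m' ?A"
      using q val by (simp add: pullback_def compose_eq)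
    also have "\<dots> = sum' (\<lambda>r. sum' m' {p \<in> ?A. f p = r}) ?B"
      by (rule sum'_over_fibres(2)[OF fin[OF q] img, symmetric])
    also have "\<dots> = sum' (pushforward P Q f m') ?B"
      by (rule sum.cong') (simp_all only: push)
    finally show "pullback Q g m q = sum' (pushforward P Q f m') ?B" .
  qed
qed

theorem theorem3p3:
  fixes P :: "'a gorder" and Q :: "'b gorder"
    and f :: "'a \<Rightarrow> 'b" and g :: "'b \<Rightarrow> 'a"
    and m :: "'a \<Rightarrow> int"
  assumes "galois_connection \<lparr>orderA = P, orderB = Q, lower = f, upper = g\<rparr>"
    and "moebius_invertible P m"
  shows "moebius_invertible Q (pullback Q g m) \<and>
         pushforward_defined P Q f (moebius_deriv P m) \<and>
         moebius_deriv Q (pullback Q g m) = pushforward P Q f (moebius_deriv P m)"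
proof -
  interpret galois_connection "\<lparr>orderA = P, orderB = Q, lower = f, upper = g\<rparr>" by fact
  have P: "partial_order P" and Q: "partial_order Q"
    using is_order_A is_order_B by simp_all
  note inv = moebius_inversion_pullback[OF assms(1) moebius_inversion_moebius_deriv[OF P assms(2)]]
  have "moebius_deriv Q (pullback Q g m) = pushforward P Q f (moebius_deriv P m)"
    unfolding moebius_deriv_eqI[OF Q inv(2)] by (simp add: pushforward_def)
  then show ?thesis
    using inv by (auto simp: moebius_invertible_def)
qed

end
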